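(* Let $\mathcal{X}$ be a finite state space, $\pi$ a probability mass function on $\mathcal{X}$ with full support, and $m\in\mathbb{N}$, $m\ge1$. Let $P \in \mathcal{S}(\pi)$ and let $Q_0,\ldots,Q_{m-1} \in \mathcal{I}(\pi) \cap \mathcal{L}$. Define $R_0:=P$, $R_n := \overline{R_{n-1}}(Q_{(n-1) \bmod m})$ for $n\ge1$, and let $R_\infty$ be the unique minimizer of $N\mapsto D^\pi_{KL}(P\|N)$ over $N\in\bigcap_{k=0}^{m-1}\mathcal{L}(\pi,Q_k)$. Let $\Pi$ be the matrix each of whose rows equals $\pi$. If $R_n = \Pi$ for some $n \in \mathbb{N} \cup \{\infty\}$, then $$\mathrm{Tr}(P) = 1.$$
   Context: $\mathcal{L}$ is the set of transition (row-stochastic) matrices on $\mathcal{X}$; $\mathcal{S}(\pi)\subseteq\mathcal{L}$ is the set of those with $\pi P=\pi$. For a matrix $M$, $M^*(x,y)=\frac{\pi(y)}{\pi(x)}M(y,x)$. $\mathcal{I}(\pi)$ is the set of real matrices $Q$ with $Q^2=I$ and $Q^*=Q$. $\mathcal{L}(\pi,Q)$ is the set of $L\in\mathcal{S}(\pi)$ with $L^*=QLQ$. For $P\in\mathcal{S}(\pi)$ and $Q \in \mathcal{I}(\pi) \cap \mathcal{L}$, $\overline{P}(Q):=\frac12(P+QP^*Q)$. For $M,N\in\mathcal{L}$, $D^\pi_{KL}(M\|N):=\sum_x\pi(x)\sum_y M(x,y)\ln\frac{M(x,y)}{N(x,y)}\in[0,\infty]$, with $0\ln(0/0)=0$, $0\cdot\infty=0$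 and $a\ln(a/0)=+\infty$ for $a>0$. *)

theory Defs
  imports "HOL-Analysis.Analysis"
begin

text \<open>
  The finite state space is a type \<open>'x::finite\<close>; matrices indexed by it have type
  \<open>real^'x^'x\<close>, with \<open>M $ x $ y\<close> the entry in row \<open>x\<close> and column \<open>y\<close>.
\<close>

definition transition_matrices :: "(real^'x^'x) set" where
  "transition_matrices = {P. (\<forall>x y. 0 \<le> P $ x $ y) \<and> (\<forall>x. (\<Sum>y\<in>UNIV. P $ x $ y) = 1)}"

definition stationary_matrices :: "real^'x \<Rightarrow> (real^'x^'x) set" where
  "stationary_matrices \<pi> = {P \<in> transition_matrices. \<pi> v* P = \<pi>}"

definition rev_adjoint :: "real^'x \<Rightarrow> real^'x^'x \<Rightarrow> real^'x^'x" where
  "rev_adjoint \<pi> M = (\<chi> x y. \<pi> $ y / \<pi> $ x * M $ y $ x)"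

definition isometric_involutions :: "real^'x \<Rightarrow> (real^'x^'x) set" where
  "isometric_involutions \<pi> = {Q. Q ** Q = mat 1 \<and> rev_adjoint \<pi> Q = Q}"

definition reversible_matrices :: "real^'x \<Rightarrow> real^'x^'x \<Rightarrow> (real^'x^'x) set" where
  "reversible_matrices \<pi> Q = {L \<in> stationary_matrices \<pi>. rev_adjoint \<pi> L = Q ** L ** Q}"

definition avg :: "real^'x \<Rightarrow> real^'x^'x \<Rightarrow> real^'x^'x \<Rightarrow> real^'x^'x" where
  "avg \<pi> P Q = (1/2) *\<^sub>R (P + Q ** rev_adjoint \<pi> P ** Q)"

text \<open>
  The summand \<open>a ln (a / b)\<close> for \<open>a, b \<ge> 0\<close>, with the conventions \<open>0 ln (0 / b) = 0\<close> for all
  \<open>b\<close> (including \<open>b = 0\<close>) and \<open>a ln (a / 0) = \<infinity>\<close> for \<open>a > 0\<close>.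
\<close>

definition KL_term :: "real \<Rightarrow> real \<Rightarrow> ereal" where
  "KL_term a b = (if a = 0 then 0 else if b = 0 then \<infinity> else ereal (a * ln (a / b)))"

definition KL_rate :: "real^'x \<Rightarrow> real^'x^'x \<Rightarrow> real^'x^'x \<Rightarrow> ereal" where
  "KL_rate \<pi> M N = (\<Sum>x\<in>UNIV. ereal (\<pi> $ x) * (\<Sum>y\<in>UNIV. KL_term (M $ x $ y) (N $ x $ y)))"

definition KL_projection :: "real^'x \<Rightarrow> (real^'x^'x) set \<Rightarrow> real^'x^'x \<Rightarrow> real^'x^'x" where
  "KL_projection \<pi> K P = (THE R. is_arg_min (KL_rate \<pi> P) (\<lambda>N. N \<in> K) R)"

fun R_fin :: "real^'x \<Rightarrow> nat \<Rightarrow> (nat \<Rightarrow> real^'x^'x) \<Rightarrow> real^'x^'x \<Rightarrow> nat \<Rightarrow> real^'x^'x" where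
  "R_fin \<pi> m Q P 0 = P"
| "R_fin \<pi> m Q P (Suc n) = avg \<pi> (R_fin \<pi> m Q P n) (Q (n mod m))"

text \<open>
  Only \<open>Q 0, \<dots>, Q (m - 1)\<close> matter. The value at \<open>\<infinity>\<close> is the unique minimizer of the
  divergence from \<open>P\<close>, not a limit of the finite terms by definition.
\<close>

definition R_seq :: "real^'x \<Rightarrow> nat \<Rightarrow> (nat \<Rightarrow> real^'x^'x) \<Rightarrow> real^'x^'x \<Rightarrow> enat \<Rightarrow> real^'x^'x" where
  "R_seq \<pi> m Q P n = (case n of
      enat k \<Rightarrow> R_fin \<pi> m Q P k
    | \<infinity> \<Rightarrow> KL_projection \<pi> (\<Inter>k<m. reversible_matrices \<pi> (Q k)) P)"

definition rank_one_matrix :: "real^'x \<Rightarrow> real^'x^'x" where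
  "rank_one_matrix \<pi> = (\<chi> x. \<pi>)"

end

(* A stochastic involution is a permutation matrix. If Q is one with Q^* = Q, its permutation s
   preserves pi, and L^* = Q L Q says that the flow F(x,y) = pi(x) L(x,y) is invariant under the
   involution (x,y) \<mapsto> (s y, s x). The admissible N are therefore the stationary matrices whose flow is
   invariant under the finite group generated by these involutions, and by Gibbs' inequality the
   minimizer of the divergence from P is the average of the flow of P over this group. The trace
   pairs the flow with an invariant weight, so it does not change under averaging; for the
   finite steps this is the cyclicity of the trace. *)
theory Submission imports Defs begin

section \<open>Averaging over the maps generated by a set of involutions\<close>

text \<open>When all members of \<open>T\<close> are involutions, inverses of composites are
  composites again, so this is the group generated by \<open>T\<close>.\<close>

inductive_set composites :: "('a \<Rightarrow> 'a) set \<Rightarrow> ('a \<Rightarrow> 'a) set" for T where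
  id: "id \<in> composites T"
| comp: "g \<in> composites T \<Longrightarrow> t \<in> T \<Longrightarrow> g \<circ> t \<in> composites T"

text \<open>The mean runs over maps, not over the points of an orbit, so that invariance is a mere
  reindexing and no stabilizers are counted.\<close>

definition orbit_average :: "('a \<Rightarrow> 'a) set \<Rightarrow> ('a \<Rightarrow> real) \<Rightarrow> 'a \<Rightarrow> real" where
  "orbit_average T f p = (\<Sum>g\<in>composites T. f (g p)) / real (card (composites T))"

lemma card_composites_pos: "0 < card (composites (T :: ('a::finite \<Rightarrow> 'a) set))"
  using composites.id[of T] by (auto simp: card_gt_0_iff)

lemma composites_invariant:
  assumes "g \<in> composites T" and "\<And>t p. t \<in> T \<Longrightarrow> f (t p) = f p"
  shows "f (g p) = f p"
  using assms(1) by (induction arbitrary: p) (auto simp: assms(2))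

lemma composites_bij:
  assumes "g \<in> composites T" and "\<And>t p. t \<in> T \<Longrightarrow> t (t p) = p"
  shows "bij g"
  using assms(1)
proof induction
  case (comp g t)
  have "bij t"
    using assms(2)[OF comp.hyps(2)] by (intro involuntory_imp_bij)
  then show ?case
    using comp.IH bij_comp by blast
qed (rule bij_id)

text \<open>Right composition with \<open>t\<close> permutes \<open>composites T\<close> and is its
  own inverse, so it only reorders the sum.\<close>

lemma orbit_average_invariant:
  assumes "t \<in> T" and "\<And>p. t (t p) = p"
  shows "orbit_average T f (t p) = orbit_average T f p"
proof -
  have "(\<Sum>g\<in>composites T. f (g (t p))) = (\<Sum>g\<in>composites T. f (g p))"
    by (rule sum.reindex_bij_witness[where i = "\<lambda>g. g \<circ> t" and j = "\<lambda>g. g \<circ> t"])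
      (auto simp: assms fun_eq_iff intro: composites.comp)
  then show ?thesis
    by (simp add: orbit_average_def)
qed

text \<open>Exchange of two finite sums. With \<open>h\<close> constant it serves for marginals,
  with \<open>S\<close> the whole type for pairings with an invariant weight.\<close>

lemma sum_orbit_average:
  fixes T :: "('a::finite \<Rightarrow> 'a) set"
  assumes "\<And>g. g \<in> composites T \<Longrightarrow> (\<Sum>p\<in>S. f (g p) * h p) = c"
  shows "(\<Sum>p\<in>S. orbit_average T f p * h p) = c"
proof -
  have "(\<Sum>p\<in>S. orbit_average T f p * h p)
      = (\<Sum>p\<in>S. \<Sum>g\<in>composites T. f (g p) * h p) / real (card (composites T))"
    by (simp add: orbit_average_def sum_distrib_right sum_divide_distrib)
  also have "\<dots> = (\<Sum>g\<in>composites T. \<Sum>p\<in>S. f (g p) * h p) / real (card (composites T))"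
    by (subst sum.swap) simp
  also have "\<dots> = c"
    using assms card_composites_pos[of T] by (simp add: card_gt_0_iff)
  finally show ?thesis .
qed

text \<open>Each composite is a bijection preserving \<open>h\<close>, so a change of variables
  removes it. The weight \<open>h\<close> will be a logarithmic ratio of invariant flows, and later
  the weight that represents the trace.\<close>

lemma sum_orbit_average_mult_invariant:
  fixes T :: "('a::finite \<Rightarrow> 'a) set"
  assumes inv: "\<And>t p. t \<in> T \<Longrightarrow> t (t p) = p"
    and h: "\<And>t p. t \<in> T \<Longrightarrow> h (t p) = h p"
  shows "(\<Sum>p\<in>UNIV. orbit_average T f p * h p) = (\<Sum>p\<in>UNIV. f p * h p)"
proof (rule sum_orbit_average)
  fix g assume g: "g \<in> composites T"
  have "(\<Sum>p\<in>UNIV. f (g p) * h p) = (\<Sum>p\<in>UNIV. f (g p) * h (g p))"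
    using composites_invariant[of g T h] g h by simp
  also have "\<dots> = (\<Sum>p\<in>UNIV. f p * h p)"
    using sum.reindex_bij_betw[of g UNIV UNIV "\<lambda>p. f p * h p"] composites_bij[of g T] g inv by simp
  finally show "(\<Sum>p\<in>UNIV. f (g p) * h p) = (\<Sum>p\<in>UNIV. f p * h p)" .
qed

lemma orbit_average_nonneg:
  assumes "\<And>p. 0 \<le> f p"
  shows "0 \<le> orbit_average T f p"
  unfolding orbit_average_def using assms by (intro divide_nonneg_nonneg sum_nonneg) auto

text \<open>The identity is a composite, so \<open>f p\<close> is itself one of the nonnegative
  summands. This keeps the divergence from \<open>P\<close> to its average finite.\<close>

lemma orbit_average_pos:
  fixes T :: "('a::finite \<Rightarrow> 'a) set"
  assumes "\<And>p. 0 \<le> f p" and "0 < f p"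
  shows "0 < orbit_average T f p"
  unfolding orbit_average_def
  using assms card_composites_pos[of T] composites.id[of T]
  by (intro divide_pos_pos sum_pos2[where i = id]) auto

text \<open>Where the invariant \<open>f'\<close> is not positive, it is not positive along the
  whole orbit, and then no summand of the average is positive.\<close>

lemma orbit_average_pos_imp_pos:
  fixes T :: "('a::finite \<Rightarrow> 'a) set"
  assumes "0 < orbit_average T f p"
    and "\<And>t p. t \<in> T \<Longrightarrow> f' (t p) = f' p"
    and "\<And>p. 0 < f p \<Longrightarrow> 0 < f' p"
  shows "0 < f' p"
proof (rule ccontr)
  assume "\<not> 0 < f' p"
  then have "f (g p) \<le> 0" if "g \<in> composites T" for g
    using composites_invariant[of g T f' p] assms(2,3) that by (metis not_le)
  then have "orbit_average T f p \<le> 0"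
    unfolding orbit_average_def by (intro divide_nonpos_nonneg sum_nonpos) auto
  then show False using assms(1) by simp
qed

section \<open>Gibbs' inequality\<close>

text \<open>This is \<open>ln u \<le> u - 1\<close> at \<open>u = b / a\<close>, with equality only
  for \<open>u = 1\<close>. For \<open>a = 0\<close> the logarithmic term is 0.\<close>

lemma mult_ln_divide_ge:
  fixes a b :: real
  assumes "0 \<le> a" "0 \<le> b" "0 < a \<Longrightarrow> 0 < b"
  shows "a - b \<le> a * ln (a / b)"
    and "a * ln (a / b) = a - b \<Longrightarrow> a = b"
proof -
  have *: "a * (b / a - 1) = b - a" "a * ln (a / b) = - (a * ln (b / a))" if "0 < a"
    using that assms by (simp_all add: field_simps ln_div)
  show "a - b \<le> a * ln (a / b)"
  proof (cases "a = 0")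
    case False
    then have "0 < a" using assms by simp
    have "a * ln (b / a) \<le> a * (b / a - 1)"
      using \<open>0 < a\<close> assms by (intro mult_left_mono ln_le_minus_one) auto
    then show ?thesis using * \<open>0 < a\<close> by simp
  qed (use assms in simp)
  show "a = b" if eq: "a * ln (a / b) = a - b"
  proof (cases "a = 0")
    case False
    then have "0 < a" using assms by simp
    then have "a * ln (b / a) = a * (b / a - 1)" using * eq by simp
    then have "ln (b / a) = b / a - 1" using \<open>0 < a\<close> by simp
    then have "b / a = 1" using \<open>0 < a\<close> assms by (intro ln_eq_minus_one) auto
    then show ?thesis using \<open>0 < a\<close> by simp
  qed (use eq in simp)
qed

lemma Gibbs:
  fixes a b :: "'a \<Rightarrow> real"
  assumes "finite S" and "\<And>p. p \<in> S \<Longrightarrow> 0 \<le> a p" "\<And>p. p \<in> S \<Longrightarrow> 0 \<le> b p"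
    and "\<And>p. p \<in> S \<Longrightarrow> 0 < a p \<Longrightarrow> 0 < b p"
    and "sum a S = sum b S"
  shows "0 \<le> (\<Sum>p\<in>S. a p * ln (a p / b p))"
    and "(\<Sum>p\<in>S. a p * ln (a p / b p)) = 0 \<Longrightarrow> p \<in> S \<Longrightarrow> a p = b p"
proof -
  \<comment> \<open>Subtracting \<open>a p - b p\<close> makes every summand nonnegative; the totals
    agree, so the sum does not change.\<close>
  let ?d = "\<lambda>p. a p * ln (a p / b p) - (a p - b p)"
  have nonneg: "0 \<le> ?d p" if "p \<in> S" for p
    using mult_ln_divide_ge(1)[of "a p" "b p"] assms that by simp
  have sum: "sum ?d S = (\<Sum>p\<in>S. a p * ln (a p / b p))"
    using assms(5) by (simp add: sum_subtractf)
  show "0 \<le> (\<Sum>p\<in>S. a p * ln (a p / b p))"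
    using sum_nonneg[of S ?d] nonneg sum by simp
  show "a p = b p" if "(\<Sum>p\<in>S. a p * ln (a p / b p)) = 0" "p \<in> S"
  proof -
    have "?d p = 0"
      using sum_nonneg_eq_0_iff[of S ?d] nonneg sum that assms(1) by auto
    then show ?thesis
      using mult_ln_divide_ge(2)[of "a p" "b p"] assms that by simp
  qed
qed

section \<open>Flows\<close>

text \<open>The joint law of two consecutive states when \<open>M\<close> is stationary. Pairs form
  a single argument so that maps on pairs act by composition.\<close>

definition flow :: "real^'x \<Rightarrow> real^'x^'x \<Rightarrow> 'x \<times> 'x \<Rightarrow> real" where
  "flow \<pi> M = (\<lambda>(x, y). \<pi> $ x * M $ x $ y)"

definition has_marginals :: "real^'x::finite \<Rightarrow> ('x \<times> 'x \<Rightarrow> real) \<Rightarrow> bool" where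
  "has_marginals \<pi> f \<longleftrightarrow> (\<forall>x. (\<Sum>y\<in>UNIV. f (x, y)) = \<pi> $ x) \<and> (\<forall>y. (\<Sum>x\<in>UNIV. f (x, y)) = \<pi> $ y)"

text \<open>The first marginal encodes row sums equal to 1, the second one
  \<open>\<pi> v* M = \<pi>\<close>.\<close>

lemma stationary_iff_flow:
  fixes \<pi> :: "real^'x::finite"
  assumes "\<forall>x. 0 < \<pi> $ x"
  shows "M \<in> stationary_matrices \<pi> \<longleftrightarrow> (\<forall>p. 0 \<le> flow \<pi> M p) \<and> has_marginals \<pi> (flow \<pi> M)"
proof -
  have "\<pi> $ x \<noteq> 0" "0 \<le> \<pi> $ x * a \<longleftrightarrow> 0 \<le> a" for x a
    using assms by (simp_all add: less_imp_neq[symmetric] zero_le_mult_iff not_le[symmetric] less_imp_le)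
  then show ?thesis
    by (auto simp: stationary_matrices_def transition_matrices_def has_marginals_def flow_def
        vector_matrix_mult_def vec_eq_iff sum_distrib_left[symmetric])
qed

lemma flow_inject:
  fixes \<pi> :: "real^'x::finite"
  assumes "\<forall>x. 0 < \<pi> $ x" and "\<And>p. flow \<pi> M p = flow \<pi> N p"
  shows "M = N"
proof -
  have "M $ x $ y = N $ x $ y" for x y
    using assms(2)[of "(x, y)"] assms(1)[rule_format, of x] by (simp add: flow_def)
  then show ?thesis by (simp add: vec_eq_iff)
qed

lemma trace_eq_flow:
  fixes \<pi> :: "real^'x::finite"
  assumes "\<forall>x. 0 < \<pi> $ x"
  shows "trace M = (\<Sum>p\<in>UNIV. flow \<pi> M p * (if fst p = snd p then 1 / \<pi> $ fst p else 0))"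
proof -
  have "\<pi> $ x \<noteq> 0" for x using assms by (simp add: less_imp_neq[symmetric])
  then show ?thesis
    by (simp add: UNIV_Times_UNIV[symmetric] sum.cartesian_product' flow_def trace_def
        if_distrib cong: if_cong del: UNIV_Times_UNIV)
qed

text \<open>The factor \<open>\<pi> $ x\<close> cancels inside the logarithm, and the conventions
  for zero entries become a condition on supports.\<close>

lemma KL_rate_eq_flow:
  fixes \<pi> :: "real^'x::finite"
  assumes pos: "\<forall>x. 0 < \<pi> $ x"
    and "\<And>p. 0 \<le> flow \<pi> M p" "\<And>p. 0 \<le> flow \<pi> N p"
  shows "KL_rate \<pi> M N =
    (if \<forall>p. 0 < flow \<pi> M p \<longrightarrow> 0 < flow \<pi> N p
     then ereal (\<Sum>p\<in>UNIV. flow \<pi> M p * ln (flow \<pi> M p / flow \<pi> N p)) else \<infinity>)"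
proof -
  have M: "0 \<le> M $ x $ y" "0 < flow \<pi> M (x, y) \<longleftrightarrow> M $ x $ y \<noteq> 0"
    and N: "0 \<le> N $ x $ y" "0 < flow \<pi> N (x, y) \<longleftrightarrow> N $ x $ y \<noteq> 0" for x y
    using assms(2,3)[of "(x, y)"] pos[rule_format, of x]
    by (auto simp: flow_def zero_le_mult_iff zero_less_mult_iff)
  have nz: "\<pi> $ x \<noteq> 0" for x using pos by (simp add: less_imp_neq[symmetric])
  show ?thesis
  proof (cases "\<forall>p. 0 < flow \<pi> M p \<longrightarrow> 0 < flow \<pi> N p")
    case True
    then have "KL_term (M $ x $ y) (N $ x $ y) = ereal (M $ x $ y * ln (M $ x $ y / N $ x $ y))" for x y
      using M N by (auto simp: KL_term_def)
    then have "KL_rate \<pi> M N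
        = ereal (\<Sum>x\<in>UNIV. \<Sum>y\<in>UNIV. \<pi> $ x * (M $ x $ y * ln (M $ x $ y / N $ x $ y)))"
      by (simp add: KL_rate_def sum_distrib_left)
    also have "\<dots> = ereal (\<Sum>p\<in>UNIV. flow \<pi> M p * ln (flow \<pi> M p / flow \<pi> N p))"
      using nz by (simp add: UNIV_Times_UNIV[symmetric] sum.cartesian_product' flow_def
          mult.assoc del: UNIV_Times_UNIV)
    finally show ?thesis using True by simp
  next
    case False
    then obtain x y where "0 < flow \<pi> M (x, y)" "\<not> 0 < flow \<pi> N (x, y)" by auto
    then have "KL_term (M $ x $ y) (N $ x $ y) = \<infinity>"
      using M N by (auto simp: KL_term_def)
    \<comment> \<open>One infinite summand suffices: in \<open>ereal\<close>,
      \<open>\<infinity>\<close> absorbs every other term.\<close>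
    then have "(\<Sum>y\<in>UNIV. KL_term (M $ x $ y) (N $ x $ y)) = \<infinity>"
      by (subst sum_Pinfty) auto
    then have "ereal (\<pi> $ x) * (\<Sum>y\<in>UNIV. KL_term (M $ x $ y) (N $ x $ y)) = \<infinity>"
      using pos nz by simp
    then have "KL_rate \<pi> M N = \<infinity>"
      unfolding KL_rate_def by (subst sum_Pinfty) auto
    then show ?thesis using False by auto
  qed
qed

section \<open>Stochastic involutions\<close>

text \<open>An off-diagonal entry of \<open>Q ** Q\<close> is a vanishing sum of nonnegative
  products, so every product in it vanishes. This leaves a single nonzero entry in each row.\<close>

lemma stochastic_involution_permutation:
  fixes \<pi> :: "real^'x::finite"
  assumes pos: "\<forall>x. 0 < \<pi> $ x" and Q: "Q \<in> isometric_involutions \<pi> \<inter> transition_matrices"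
  obtains s where "\<And>x. s (s x) = x" "\<And>x. \<pi> $ s x = \<pi> $ x"
    "\<And>M x y. (Q ** M ** Q) $ x $ y = M $ s x $ s y"
proof -
  have Q0: "0 \<le> Q $ x $ y" and Q1: "(\<Sum>y\<in>UNIV. Q $ x $ y) = 1" for x y
    using Q by (auto simp: transition_matrices_def)
  have QQ: "(\<Sum>z\<in>UNIV. Q $ x $ z * Q $ z $ w) = (if x = w then 1 else 0)" for x w
  proof -
    have "(Q ** Q) $ x $ w = (mat 1 :: real^'x^'x) $ x $ w"
      using Q by (simp add: isometric_involutions_def)
    then show ?thesis by (simp add: matrix_matrix_mult_def mat_def)
  qed
  have off: "Q $ y $ w = 0" if "0 < Q $ x $ y" "w \<noteq> x" for x y w
  proof -
    have "(\<Sum>z\<in>UNIV. Q $ x $ z * Q $ z $ w) = 0" using QQ that by simp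
    then have "Q $ x $ y * Q $ y $ w = 0"
      using sum_nonneg_eq_0_iff[of UNIV "\<lambda>z. Q $ x $ z * Q $ z $ w"] Q0 by simp
    then show ?thesis using that by simp
  qed
  have row: "Q $ y $ x = 1" if "0 < Q $ x $ y" for x y
    using Q1[of y] off[OF that] sum.remove[of UNIV x "\<lambda>w. Q $ y $ w"] by simp
  have "\<exists>y. 0 < Q $ x $ y" for x
  proof (rule ccontr)
    assume "\<nexists>y. 0 < Q $ x $ y"
    then have "Q $ x $ y = 0" for y using Q0[of x y] by (metis less_eq_real_def)
    then show False using Q1[of x] by simp
  qed
  then obtain s where "\<And>x. 0 < Q $ x $ s x" by metis
  \<comment> \<open>\<open>row\<close> is applied twice: positivity at \<open>(x, s x)\<close> gives
    1 at the transposed place, and this positivity gives 1 back at \<open>(x, s x)\<close>.\<close>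
  then have s1: "Q $ s x $ x = 1" and s2: "Q $ x $ s x = 1" for x
    using row[of x "s x"] row[of "s x" x] by auto
  have Qs: "Q $ x $ y = (if y = s x then 1 else 0)" for x y
    using off[of "s x" x y] s1[of x] s2[of x] by auto
  have ss: "s (s x) = x" for x
    using Qs[of "s x" x] s1[of x] by (auto split: if_splits)
  \<comment> \<open>The form that singles out the nonzero entry of a column, for multiplication by
    \<open>Q\<close> from the right.\<close>
  then have Qs': "Q $ x $ y = (if x = s y then 1 else 0)" for x y
    using Qs[of x y] by (metis (full_types))
  \<comment> \<open>Self-adjointness is read at \<open>(x, s x)\<close>, where both entries of
    \<open>Q\<close> involved are 1.\<close>
  have "\<pi> $ s x = \<pi> $ x" for x
  proof -
    have "rev_adjoint \<pi> Q $ x $ s x = Q $ x $ s x"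
      using Q by (simp add: isometric_involutions_def)
    then show ?thesis
      using pos[rule_format, of x] by (simp add: rev_adjoint_def s1 s2 field_simps)
  qed
  moreover have "(Q ** M ** Q) $ x $ y = M $ s x $ s y" for M x y
  proof -
    have "(Q ** M) $ x $ z = M $ s x $ z" for z
      by (simp add: matrix_matrix_mult_def Qs if_distrib[of "\<lambda>a. a * _"] cong: if_cong)
    then have "(Q ** M ** Q) $ x $ y = (\<Sum>z\<in>UNIV. M $ s x $ z * Q $ z $ y)"
      by (simp add: matrix_matrix_mult_def)
    then show ?thesis
      by (simp add: Qs' if_distrib[of "\<lambda>a. _ * a"] cong: if_cong)
  qed
  ultimately show ?thesis using ss that by blast
qed

text \<open>Time reversal of a transition, combined with relabelling of the states by
  \<open>s\<close>.\<close>

definition twisted_flip :: "('x \<Rightarrow> 'x) \<Rightarrow> 'x \<times> 'x \<Rightarrow> 'x \<times> 'x" where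
  "twisted_flip s = (\<lambda>(x, y). (s y, s x))"

lemma reversible_iff_flow_invariant:
  fixes \<pi> :: "real^'x::finite"
  assumes pos: "\<forall>x. 0 < \<pi> $ x"
    and s: "\<And>x. s (s x) = x" "\<And>x. \<pi> $ s x = \<pi> $ x"
    and Q: "\<And>M x y. (Q ** M ** Q) $ x $ y = M $ s x $ s y"
  shows "L \<in> reversible_matrices \<pi> Q \<longleftrightarrow>
    L \<in> stationary_matrices \<pi> \<and> (\<forall>p. flow \<pi> L (twisted_flip s p) = flow \<pi> L p)"
proof -
  have nz: "\<pi> $ x \<noteq> 0" for x using pos by (simp add: less_imp_neq[symmetric])
  have "rev_adjoint \<pi> L = Q ** L ** Q \<longleftrightarrow> (\<forall>x y. \<pi> $ y * L $ y $ x = \<pi> $ x * L $ s x $ s y)"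
    using nz by (auto simp: vec_eq_iff rev_adjoint_def Q field_simps)
  also have "\<dots> \<longleftrightarrow> (\<forall>p. flow \<pi> L (twisted_flip s p) = flow \<pi> L p)"
    by (auto simp: flow_def twisted_flip_def s)
  finally show ?thesis by (simp add: reversible_matrices_def)
qed

text \<open>The flip exchanges the two marginals, which are equal, and \<open>s\<close> only
  permutes states of the same mass.\<close>

lemma has_marginals_twisted_flip:
  assumes s: "\<And>x. s (s x) = x" "\<And>x. \<pi> $ s x = \<pi> $ x" and f: "has_marginals \<pi> f"
  shows "has_marginals \<pi> (f \<circ> twisted_flip s)"
proof -
  have "bij s" using s(1) by (intro involuntory_imp_bij)
  then have "(\<Sum>y\<in>UNIV. f (s y, x)) = (\<Sum>y\<in>UNIV. f (y, x))"
    "(\<Sum>y\<in>UNIV. f (x, s y)) = (\<Sum>y\<in>UNIV. f (x, y))" for x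
    using sum.reindex_bij_betw[of s UNIV UNIV "\<lambda>y. f (y, x)"]
      sum.reindex_bij_betw[of s UNIV UNIV "\<lambda>y. f (x, y)"] by auto
  then show ?thesis
    using f s(2) by (simp add: has_marginals_def twisted_flip_def)
qed

lemma has_marginals_composites:
  assumes "g \<in> composites T" and "has_marginals \<pi> f"
    and "\<And>t f. t \<in> T \<Longrightarrow> has_marginals \<pi> f \<Longrightarrow> has_marginals \<pi> (f \<circ> t)"
  shows "has_marginals \<pi> (f \<circ> g)"
  using assms(1)
proof induction
  case (comp g t)
  then show ?case using assms(3)[of t "f \<circ> g"] by (simp only: comp_assoc)
qed (simp add: assms(2))

lemma has_marginals_orbit_average:
  fixes \<pi> :: "real^'x::finite"
  assumes "\<And>g. g \<in> composites T \<Longrightarrow> has_marginals \<pi> (f \<circ> g)"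
  shows "has_marginals \<pi> (orbit_average T f)"
proof -
  have "(\<Sum>p\<in>Pair x ` UNIV. orbit_average T f p * 1) = \<pi> $ x" for x
    using assms by (intro sum_orbit_average) (simp add: sum.reindex inj_on_def has_marginals_def)
  moreover have "(\<Sum>p\<in>(\<lambda>x. (x, y)) ` UNIV. orbit_average T f p * 1) = \<pi> $ y" for y
    using assms by (intro sum_orbit_average) (simp add: sum.reindex inj_on_def has_marginals_def)
  ultimately show ?thesis
    by (simp add: sum.reindex inj_on_def has_marginals_def)
qed

lemma sum_flow:
  fixes \<pi> :: "real^'x::finite"
  assumes "has_marginals \<pi> f"
  shows "sum f UNIV = (\<Sum>x\<in>UNIV. \<pi> $ x)"
  using assms unfolding has_marginals_def
  by (simp add: UNIV_Times_UNIV[symmetric] sum.cartesian_product' del: UNIV_Times_UNIV)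

section \<open>The projection and the trace\<close>

text \<open>A Pythagorean identity: if \<open>R\<close> has the averaged flow and \<open>N\<close>
  in \<open>K\<close> covers the support of \<open>P\<close>, then D(P||N) = D(P||R) + D(R||N), and
  Gibbs' inequality applies to the last term.\<close>

lemma KL_projection_eq_orbit_average:
  fixes \<pi> :: "real^'x::finite"
  assumes pos: "\<forall>x. 0 < \<pi> $ x" and P: "P \<in> stationary_matrices \<pi>"
    and inv: "\<And>t p. t \<in> T \<Longrightarrow> t (t p) = p"
    and marg: "\<And>t f. t \<in> T \<Longrightarrow> has_marginals \<pi> f \<Longrightarrow> has_marginals \<pi> (f \<circ> t)"
    and K: "\<And>L. L \<in> K \<longleftrightarrow> L \<in> stationary_matrices \<pi> \<and> (\<forall>t\<in>T. \<forall>p. flow \<pi> L (t p) = flow \<pi> L p)"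
  shows "flow \<pi> (KL_projection \<pi> K P) = orbit_average T (flow \<pi> P)"
proof -
  define F where "F = flow \<pi> P"
  define R :: "real^'x^'x" where "R = (\<chi> x y. orbit_average T F (x, y) / \<pi> $ x)"
  have nz: "\<pi> $ x \<noteq> 0" for x using pos by (simp add: less_imp_neq[symmetric])
  have flowR: "flow \<pi> R = orbit_average T F"
    by (auto simp: flow_def R_def nz)
  have F0: "0 \<le> F p" and Fm: "has_marginals \<pi> F" for p
    using P stationary_iff_flow[OF pos] unfolding F_def by blast+
  have R0: "0 \<le> flow \<pi> R p" for p
    unfolding flowR using F0 by (rule orbit_average_nonneg)
  have Rm: "has_marginals \<pi> (flow \<pi> R)"
    unfolding flowR by (intro has_marginals_orbit_average has_marginals_composites[OF _ Fm] marg)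
  have Rinv: "flow \<pi> R (t p) = flow \<pi> R p" if "t \<in> T" for t p
    unfolding flowR using that inv by (intro orbit_average_invariant) auto
  have RK: "R \<in> K" using K R0 Rm Rinv pos by (simp add: stationary_iff_flow)
  have FR: "0 < flow \<pi> R p" if "0 < F p" for p
    unfolding flowR using F0 that by (rule orbit_average_pos)
  have KLR: "KL_rate \<pi> P R = ereal (\<Sum>p\<in>UNIV. F p * ln (F p / flow \<pi> R p))"
    using KL_rate_eq_flow[OF pos, of P R] F0 R0 FR by (simp add: F_def)
  \<comment> \<open>The second conjunct is the uniqueness that \<open>THE\<close> in
    \<open>KL_projection\<close> requires.\<close>
  have key: "KL_rate \<pi> P R \<le> KL_rate \<pi> P N \<and> (KL_rate \<pi> P N \<le> KL_rate \<pi> P R \<longrightarrow> N = R)"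
    if NK: "N \<in> K" for N
  proof -
    note NK' = NK[unfolded K stationary_iff_flow[OF pos]]
    have N0: "0 \<le> flow \<pi> N p" for p
      by (rule conjunct1[OF conjunct1[OF NK'], rule_format])
    show ?thesis
    proof (cases "\<forall>p. 0 < F p \<longrightarrow> 0 < flow \<pi> N p")
      case True
      let ?h = "\<lambda>p. ln (flow \<pi> R p / flow \<pi> N p)"
      have Nm: "has_marginals \<pi> (flow \<pi> N)"
        by (rule conjunct2[OF conjunct1[OF NK']])
      have Ninv: "flow \<pi> N (t p) = flow \<pi> N p" if "t \<in> T" for t p
        by (rule conjunct2[OF NK', rule_format, OF that])
      have KLN: "KL_rate \<pi> P N = ereal (\<Sum>p\<in>UNIV. F p * ln (F p / flow \<pi> N p))"
        using KL_rate_eq_flow[OF pos, of P N] F0 N0 True by (simp add: F_def)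
      have RN: "0 < flow \<pi> N p" if "0 < flow \<pi> R p" for p
        using that[unfolded flowR] Ninv True[rule_format] by (rule orbit_average_pos_imp_pos)
      have split: "F p * ln (F p / flow \<pi> N p) = F p * ln (F p / flow \<pi> R p) + F p * ?h p" for p
      proof (cases "F p = 0")
        case False
        then have "0 < F p" using F0[of p] by simp
        then show ?thesis using FR[of p] RN[of p] by (simp add: ln_div algebra_simps)
      qed simp
      have hinv: "?h (t p) = ?h p" if "t \<in> T" for t p
        using Ninv[OF that, of p] Rinv[OF that, of p] by simp
      \<comment> \<open>As \<open>?h\<close> is invariant, the flow of \<open>P\<close> may be
        replaced by its average; this turns the cross term into D(R||N).\<close>
      have "(\<Sum>p\<in>UNIV. flow \<pi> R p * ?h p) = (\<Sum>p\<in>UNIV. F p * ?h p)"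
        using inv hinv unfolding flowR by (rule sum_orbit_average_mult_invariant)
      then have diff: "(\<Sum>p\<in>UNIV. F p * ln (F p / flow \<pi> N p))
          = (\<Sum>p\<in>UNIV. F p * ln (F p / flow \<pi> R p)) + (\<Sum>p\<in>UNIV. flow \<pi> R p * ?h p)"
        by (simp add: split sum.distrib)
      note Gibbs = Gibbs[of UNIV "flow \<pi> R" "flow \<pi> N", OF _ R0 N0 RN]
      have ge: "0 \<le> (\<Sum>p\<in>UNIV. flow \<pi> R p * ?h p)"
        using Gibbs(1) sum_flow[OF Rm] sum_flow[OF Nm] by simp
      moreover have "N = R" if "(\<Sum>p\<in>UNIV. flow \<pi> R p * ?h p) = 0"
        using Gibbs(2) sum_flow[OF Rm] sum_flow[OF Nm] that by (intro flow_inject[OF pos]) simp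
      ultimately show ?thesis
        unfolding KLN KLR diff by auto
    next
      case False
      have "KL_rate \<pi> P N = \<infinity>"
        using KL_rate_eq_flow[OF pos, of P N] F0 N0 False by (auto simp: F_def)
      then show ?thesis using KLR by simp
    qed
  qed
  have "KL_projection \<pi> K P = R"
    unfolding KL_projection_def
    using RK key by (intro the_equality) (auto simp: is_arg_min_def not_less)
  then show ?thesis using flowR by (simp add: F_def)
qed

text \<open>Cyclicity brings the two factors \<open>Q\<close> together, where they cancel, and the
  adjoint has the same diagonal as \<open>M\<close>.\<close>

lemma trace_avg:
  fixes \<pi> :: "real^'x::finite"
  assumes pos: "\<forall>x. 0 < \<pi> $ x" and Q: "Q \<in> isometric_involutions \<pi>"
  shows "trace (avg \<pi> M Q) = trace M"
proof -
  have nz: "\<pi> $ x \<noteq> 0" for x using pos by (simp add: less_imp_neq[symmetric])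
  have "trace (Q ** rev_adjoint \<pi> M ** Q) = trace (Q ** (Q ** rev_adjoint \<pi> M))"
    by (rule trace_mul_sym)
  also have "\<dots> = trace (rev_adjoint \<pi> M)"
    using Q by (simp add: matrix_mul_assoc isometric_involutions_def)
  also have "\<dots> = trace M"
    by (simp add: trace_def rev_adjoint_def nz)
  finally show ?thesis
    unfolding avg_def by (simp add: trace_def sum_distrib_left[symmetric] sum.distrib
        sum_divide_distrib[symmetric])
qed

lemma trace_KL_projection:
  fixes \<pi> :: "real^'x::finite" and Q :: "nat \<Rightarrow> real^'x^'x"
  assumes pos: "\<forall>x. 0 < \<pi> $ x" and m: "1 \<le> m" and P: "P \<in> stationary_matrices \<pi>"
    and Q: "\<forall>k<m. Q k \<in> isometric_involutions \<pi> \<inter> transition_matrices"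
  shows "trace (KL_projection \<pi> (\<Inter>k<m. reversible_matrices \<pi> (Q k)) P) = trace P"
proof -
  have "\<exists>s. (\<forall>x. s (s x) = x) \<and> (\<forall>x. \<pi> $ s x = \<pi> $ x) \<and>
      (\<forall>M x y. (Q k ** M ** Q k) $ x $ y = M $ s x $ s y)" if "k < m" for k
    using stochastic_involution_permutation[OF pos Q[rule_format, OF that]] by metis
  then obtain s where s: "\<And>k x. k < m \<Longrightarrow> s k (s k x) = x" "\<And>k x. k < m \<Longrightarrow> \<pi> $ s k x = \<pi> $ x"
    and Qs: "\<And>k M x y. k < m \<Longrightarrow> (Q k ** M ** Q k) $ x $ y = M $ s k x $ s k y"
    by metis
  define T where "T = (\<lambda>k. twisted_flip (s k)) ` {..<m}"
  let ?K = "\<Inter>k<m. reversible_matrices \<pi> (Q k)"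
  have inv: "t (t p) = p" if "t \<in> T" for t p
    using that s by (auto simp: T_def twisted_flip_def split: prod.splits)
  have marg: "has_marginals \<pi> (f \<circ> t)" if "t \<in> T" "has_marginals \<pi> f" for t f
    using that s by (auto simp: T_def intro: has_marginals_twisted_flip)
  have rev: "L \<in> reversible_matrices \<pi> (Q k) \<longleftrightarrow> L \<in> stationary_matrices \<pi> \<and>
      (\<forall>p. flow \<pi> L (twisted_flip (s k) p) = flow \<pi> L p)" if "k < m" for L k
    using that s Qs by (intro reversible_iff_flow_invariant[OF pos]) auto
  have K: "L \<in> ?K \<longleftrightarrow> L \<in> stationary_matrices \<pi> \<and> (\<forall>t\<in>T. \<forall>p. flow \<pi> L (t p) = flow \<pi> L p)" for L
  proof -
    have "L \<in> ?K \<longleftrightarrow> (\<forall>k<m. L \<in> stationary_matrices \<pi> \<and>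
        (\<forall>p. flow \<pi> L (twisted_flip (s k) p) = flow \<pi> L p))"
      using rev by auto
    also have "\<dots> \<longleftrightarrow> L \<in> stationary_matrices \<pi> \<and> (\<forall>t\<in>T. \<forall>p. flow \<pi> L (t p) = flow \<pi> L p)"
      \<comment> \<open>Since \<open>1 \<le> m\<close>, the index 0 is available and supplies
        stationarity; an empty intersection would be the set of all matrices.\<close>
      using m unfolding T_def by (auto dest: spec[of _ 0])
    finally show ?thesis .
  qed
  let ?w = "\<lambda>p. if fst p = snd p then 1 / \<pi> $ fst p else 0"
  \<comment> \<open>A twisted flip sends \<open>(x, x)\<close> to \<open>(s k x, s k x)\<close> and
    keeps other pairs off the diagonal, and \<open>s k\<close> preserves
    \<open>\<pi>\<close>.\<close>
  have w: "?w (t p) = ?w p" if "t \<in> T" for t p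
  proof -
    obtain k where k: "k < m" "t = twisted_flip (s k)" using \<open>t \<in> T\<close> unfolding T_def by blast
    have "s k x = s k y \<longleftrightarrow> x = y" for x y using s(1)[OF k(1)] by metis
    then show ?thesis using k s(2) by (cases p) (auto simp: twisted_flip_def)
  qed
  have "flow \<pi> (KL_projection \<pi> ?K P) = orbit_average T (flow \<pi> P)"
    using pos P inv marg K by (rule KL_projection_eq_orbit_average)
  then have "trace (KL_projection \<pi> ?K P) = (\<Sum>p\<in>UNIV. orbit_average T (flow \<pi> P) p * ?w p)"
    unfolding trace_eq_flow[OF pos] by simp
  also have "\<dots> = trace P"
    unfolding trace_eq_flow[OF pos] using inv w by (rule sum_orbit_average_mult_invariant)
  finally show ?thesis .
qed

theorem corollary5p1:
  fixes \<pi> :: "real^'x::finite" and m :: nat and n :: enat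
    and P :: "real^'x^'x" and Q :: "nat \<Rightarrow> real^'x^'x"
  assumes "\<forall>x. 0 < \<pi> $ x" and "(\<Sum>x\<in>UNIV. \<pi> $ x) = 1"
    and "1 \<le> m"
    and "P \<in> stationary_matrices \<pi>"
    and "\<forall>k<m. Q k \<in> isometric_involutions \<pi> \<inter> transition_matrices"
    and "R_seq \<pi> m Q P n = rank_one_matrix \<pi>"
  shows "trace P = 1"
proof -
  have "trace (R_fin \<pi> m Q P k) = trace P" for k
  proof (induction k)
    case (Suc k)
    have "Q (k mod m) \<in> isometric_involutions \<pi>" using assms(3,5) by auto
    then show ?case using Suc trace_avg[OF assms(1)] by simp
  qed simp
  \<comment> \<open>The induction covers finite indices and the projection covers
    \<open>\<infinity>\<close>, so the trace is constant along the whole sequence.\<close>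
  then have "trace (R_seq \<pi> m Q P n) = trace P"
    using trace_KL_projection[OF assms(1,3,4,5)] by (simp add: R_seq_def split: enat.split)
  moreover have "trace (rank_one_matrix \<pi>) = 1"
    using assms(2) by (simp add: trace_def rank_one_matrix_def)
  ultimately show ?thesis using assms(6) by simp
qed

end
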